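(* Fix a consumer $i$ and a data outflow $Y=(Y_0,Y_1,\dots,Y_N)$ such that $Y_0$ is measurable with respect to $Y_i$. Then: 1. (Producer) $\Pi_i((S_i,Y_i),Y_0)-\Pi_i(S_i,\varnothing)=\tfrac14 G(Y_0)$. 2. (Consumer $i$) $U_i((S_i,Y_i),Y_0)-U_i(S_i,\varnothing)=\tfrac12\big(G(S_i,Y_i)-G(S_i)\big)-\tfrac38 G(Y_0)$. 3. (Social surplus) $W_i((S_i,Y_i),Y_0)-W_i(S_i,\varnothing)=\tfrac12\big(G(S_i,Y_i)-G(S_i)\big)-\tfrac18 G(Y_0)$.
   Context: There are $N$ consumers and one producer. The vectors $w=(w_1,\dots,w_N)$ (willingness to pay) and $e=(e_1,\dots,e_N)$ (errors) are independent of each other, each is exchangeable (distribution invariant under permutations of indices), with $\mathbb E[w_i]=\mu$, $\operatorname{var}[w_i]=1$, $\mathbb E[e_i]=0$, $\operatorname{var}[e_i]=1$; their distributions are otherwise arbitrary. Consumer $i$ observes $s_i=w_i+\sigma e_i$, $\sigma>0$; $S_i$ denotes the information $s_i$ and $S=(s_1,\dots,s_N)$. A data outflow consists of signals $Y_0$ (to the producer) and $Y_i$ (to consumer $i$), each a (possibly randomized, with randomization independent of $(w,e)$) function of the data collected from $S$. $\varnothing$ denotes no information. Product market: facing unit price $p_i$ consumer $i$ buys quantity $q_i\in\mathbb R$ with utility $w_iq_i-p_iq_i-\tfrac12q_i^2$; the producer's profit from consumer $i$ is $(p_i-c)q_i$, with $c\ge 0$ constant. When consumer $i$ has information $I$ and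 the producer has information $Y_0$ (measurable with respect to $I$), the outcome is $p_i^*=\tfrac12(\mathbb E[w_i\mid Y_0]+c)$ and $q_i^*=\mathbb E[w_i\mid I]-p_i^*$. Define the ex ante payoffs $\Pi_i(I,Y_0)=\mathbb E[(p_i^*-c)q_i^*]$, $U_i(I,Y_0)=\mathbb E[w_iq_i^*-p_i^*q_i^*-\tfrac12(q_i^* )^2]$ and $W_i=\Pi_i+U_i$. Gain function: for any information $Y$, $G(Y)=\operatorname{var}\big[\mathbb E[w_i\mid Y]\big]$. *)

theory Defs
  imports "HOL-Probability.Probability" "HOL-Combinatorics.Permutations"
begin

text \<open>
  Consumers are indexed by \<open>{1..N}\<close>, and index \<open>0\<close> stands for the producer.
  Information is represented by the sub-\<open>\<sigma>\<close>-algebra it generates on \<open>space M\<close>; only the sets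
  of such a measure matter for \<^const>\<open>real_cond_exp\<close>.
\<close>

definition info :: "'a measure \<Rightarrow> 'y measure \<Rightarrow> ('a \<Rightarrow> 'y) \<Rightarrow> 'a measure" where
  "info M L y = vimage_algebra (space M) y L"

definition no_info :: "'a measure \<Rightarrow> 'a measure" where
  "no_info M = sigma (space M) {}"

definition profile :: "nat \<Rightarrow> (nat \<Rightarrow> 'a \<Rightarrow> real) \<Rightarrow> 'a \<Rightarrow> nat \<Rightarrow> real" where
  "profile N x \<omega> = (\<lambda>j\<in>{1..N}. x j \<omega>)"

abbreviation profile_space :: "nat \<Rightarrow> (nat \<Rightarrow> real) measure" where
  "profile_space N \<equiv> PiM {1..N} (\<lambda>_. borel)"

definition exchangeable :: "'a measure \<Rightarrow> nat \<Rightarrow> (nat \<Rightarrow> 'a \<Rightarrow> real) \<Rightarrow> bool" where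
  "exchangeable M N x \<longleftrightarrow>
     (\<forall>\<pi>. \<pi> permutes {1..N} \<longrightarrow>
        distr M (profile_space N) (profile N (\<lambda>j. x (\<pi> j))) =
        distr M (profile_space N) (profile N x))"

definition observation ::
    "(nat \<Rightarrow> 'a \<Rightarrow> real) \<Rightarrow> (nat \<Rightarrow> 'a \<Rightarrow> real) \<Rightarrow> real \<Rightarrow> nat \<Rightarrow> 'a \<Rightarrow> real" where
  "observation w e \<sigma> j \<omega> = w j \<omega> + \<sigma> * e j \<omega>"

text \<open>
  The variable \<open>u\<close> is the randomization device. It is common to all recipients, so
  the signals may be correlated given the consumers' observations; private randomization is the case
  where each signal depends on its own component of \<open>u\<close>. The signals share one type
  \<open>'y\<close> but may take values in different measurable spaces \<open>L j\<close>. Independence of \<open>u\<close> from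
  \<open>(w, e)\<close> is stated via generated \<open>\<sigma>\<close>-algebras because \<open>indep_var\<close> requires both variables
  to have the same type.
\<close>

definition data_outflow ::
    "'a measure \<Rightarrow> nat \<Rightarrow> (nat \<Rightarrow> 'a \<Rightarrow> real) \<Rightarrow> (nat \<Rightarrow> 'a \<Rightarrow> real) \<Rightarrow> real \<Rightarrow>
     'u measure \<Rightarrow> ('a \<Rightarrow> 'u) \<Rightarrow> (nat \<Rightarrow> 'y measure) \<Rightarrow> (nat \<Rightarrow> 'a \<Rightarrow> 'y) \<Rightarrow> bool" where
  "data_outflow M N w e \<sigma> R u L Y \<longleftrightarrow>
     u \<in> measurable M R \<and>
     prob_space.indep_set M
       (sets (info M (profile_space N \<Otimes>\<^sub>M profile_space N) (\<lambda>\<omega>. (profile N w \<omega>, profile N e \<omega>))))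
       (sets (info M R u)) \<and>
     (\<forall>j\<in>{0..N}. \<exists>f \<in> measurable (profile_space N \<Otimes>\<^sub>M R) (L j).
        \<forall>\<omega>\<in>space M. Y j \<omega> = f (profile N (observation w e \<sigma>) \<omega>, u \<omega>))"

text \<open>
  In the following, \<open>v\<close> is the willingness to pay of the consumer under consideration,
  \<open>I\<close> the consumer's information and \<open>F\<close> the producer's.
\<close>

definition price :: "'a measure \<Rightarrow> real \<Rightarrow> ('a \<Rightarrow> real) \<Rightarrow> 'a measure \<Rightarrow> 'a \<Rightarrow> real" where
  "price M c v F \<omega> = (real_cond_exp M F v \<omega> + c) / 2"

definition quantity ::
    "'a measure \<Rightarrow> real \<Rightarrow> ('a \<Rightarrow> real) \<Rightarrow> 'a measure \<Rightarrow> 'a measure \<Rightarrow> 'a \<Rightarrow> real" where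
  "quantity M c v I F \<omega> = real_cond_exp M I v \<omega> - price M c v F \<omega>"

definition producer_payoff ::
    "'a measure \<Rightarrow> real \<Rightarrow> ('a \<Rightarrow> real) \<Rightarrow> 'a measure \<Rightarrow> 'a measure \<Rightarrow> real" where
  "producer_payoff M c v I F =
     prob_space.expectation M (\<lambda>\<omega>. (price M c v F \<omega> - c) * quantity M c v I F \<omega>)"

definition consumer_payoff ::
    "'a measure \<Rightarrow> real \<Rightarrow> ('a \<Rightarrow> real) \<Rightarrow> 'a measure \<Rightarrow> 'a measure \<Rightarrow> real" where
  "consumer_payoff M c v I F =
     prob_space.expectation M (\<lambda>\<omega>. v \<omega> * quantity M c v I F \<omega>
       - price M c v F \<omega> * quantity M c v I F \<omega> - (quantity M c v I F \<omega>)\<^sup>2 / 2)"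

definition social_surplus ::
    "'a measure \<Rightarrow> real \<Rightarrow> ('a \<Rightarrow> real) \<Rightarrow> 'a measure \<Rightarrow> 'a measure \<Rightarrow> real" where
  "social_surplus M c v I F = producer_payoff M c v I F + consumer_payoff M c v I F"

definition gain :: "'a measure \<Rightarrow> ('a \<Rightarrow> real) \<Rightarrow> 'a measure \<Rightarrow> real" where
  "gain M v F = prob_space.variance M (real_cond_exp M F v)"

end

theory Submission
  imports Defs
begin

text \<open>
  Write \<open>a\<close> and \<open>b\<close> for the conditional expectations of \<open>v\<close> given the producer's and the consumer's
  information. Since the former is contained in the latter, \<open>a\<close> and \<open>b\<close> are both orthogonal
  to \<open>v - b\<close>, so \<open>E[a b] = E[a v] = E[a\<^sup>2]\<close> and \<open>E[v b] = E[b\<^sup>2]\<close>. Hence both payoffs are affine in the two gains, with the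
  constant terms depending on \<open>E[v] - c\<close> only, and these cancel in the comparison with the benchmark,
  where the producer's gain is zero.
\<close>

text \<open>The bound \<open>\<bar>a * b\<bar> \<le> a\<^sup>2 + b\<^sup>2\<close> dominates the
  product. Only second moments are assumed of the willingness to pay, so every cross term in the
  payoffs gets its integrability from here.\<close>

lemma integrable_mult_of_squares:
  fixes f g :: "'a \<Rightarrow> real"
  assumes "f \<in> borel_measurable M" "g \<in> borel_measurable M"
    and "integrable M (\<lambda>x. (f x)\<^sup>2)" "integrable M (\<lambda>x. (g x)\<^sup>2)"
  shows "integrable M (\<lambda>x. f x * g x)"
proof (rule Bochner_Integration.integrable_bound)
  show "integrable M (\<lambda>x. (f x)\<^sup>2 + (g x)\<^sup>2)"
    using assms by simp
  have "\<bar>a * b\<bar> \<le> a\<^sup>2 + b\<^sup>2" for a b :: real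
    using sum_squares_bound[of "\<bar>a\<bar>" "\<bar>b\<bar>"] abs_ge_zero[of "a * b"]
    unfolding abs_mult power2_abs by linarith
  then show "AE x in M. norm (f x * g x) \<le> norm ((f x)\<^sup>2 + (g x)\<^sup>2)"
    by simp
qed (use assms in simp)

lemma space_no_info[simp]: "space (no_info M) = space M"
  by (simp add: no_info_def)

lemma sets_no_info: "sets (no_info M) = {{}, space M}"
  by (simp add: no_info_def sigma_sets_empty_eq)

lemma subalgebra_no_info:
  assumes "space A = space M"
  shows "subalgebra A (no_info M)"
  using assms sets.top[of A] by (simp add: subalgebra_def sets_no_info)

context prob_space
begin

text \<open>A finite measure stays finite when restricted to a smaller \<sigma>-algebra, so
  conditional expectations are available for every kind of information.\<close>

lemma sigma_finite_subalgebraI: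
  assumes "subalgebra M F"
  shows "sigma_finite_subalgebra M F"
  by (intro finite_measure_subalgebra_is_sigma_finite finite_measure_subalgebra.intro
      finite_measure_subalgebra_axioms.intro finite_measure_axioms assms)

text \<open>Conditional Jensen for the convex function \<open>x\<^sup>2\<close>: the square of the
  conditional expectation lies below the conditional expectation of \<open>v\<^sup>2\<close>, which
  is integrable.\<close>

lemma square_integrable_cond_exp:
  assumes "subalgebra M F" "v \<in> borel_measurable M" "integrable M (\<lambda>x. (v x)\<^sup>2)"
  shows "integrable M (\<lambda>x. (real_cond_exp M F v x)\<^sup>2)"
proof -
  interpret F: sigma_finite_subalgebra M F
    using assms(1) by (rule sigma_finite_subalgebraI)
  show ?thesis
    by (rule F.integrable_convex_cond_exp[where I = UNIV])
      (auto simp: assms convex_power2 square_integrable_imp_integrable[OF assms(2,3)])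
qed

text \<open>An \<open>I\<close>-measurable factor can be pulled inside the conditional expectation,
  and the tower property then removes the conditioning. The two second moments make
  \<open>f * v\<close> integrable.\<close>

lemma expectation_mult_cond_exp:
  fixes f v :: "'a \<Rightarrow> real"
  assumes "subalgebra M I" "f \<in> borel_measurable I" "v \<in> borel_measurable M"
    and "integrable M (\<lambda>x. (f x)\<^sup>2)" "integrable M (\<lambda>x. (v x)\<^sup>2)"
  shows "expectation (\<lambda>x. f x * real_cond_exp M I v x) = expectation (\<lambda>x. f x * v x)"
proof -
  interpret I: sigma_finite_subalgebra M I
    using assms(1) by (rule sigma_finite_subalgebraI)
  have "f \<in> borel_measurable M"
    using assms(1,2) by (rule measurable_from_subalg)
  then show ?thesis
    using assms by (intro I.real_cond_exp_intg(2) integrable_mult_of_squares) auto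
qed

lemma gain_eq:
  assumes "subalgebra M F" "v \<in> borel_measurable M" "integrable M (\<lambda>x. (v x)\<^sup>2)"
  shows "gain M v F = expectation (\<lambda>x. (real_cond_exp M F v x)\<^sup>2) - (expectation v)\<^sup>2"
proof -
  interpret F: sigma_finite_subalgebra M F
    using assms(1) by (rule sigma_finite_subalgebraI)
  have "integrable M v"
    using assms(2,3) by (rule square_integrable_imp_integrable)
  then show ?thesis
    unfolding gain_def
    by (subst variance_eq) (simp_all add: square_integrable_cond_exp[OF assms] F.real_cond_exp_int)
qed

lemma payoffs_eq:
  fixes v :: "'a \<Rightarrow> real"
  assumes F: "subalgebra M F" and I: "subalgebra M I" and FI: "subalgebra I F"
    and v[measurable]: "v \<in> borel_measurable M" and v2: "integrable M (\<lambda>x. (v x)\<^sup>2)"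
  shows producer_payoff_eq:
      "producer_payoff M c v I F = gain M v F / 4 + (expectation v - c)\<^sup>2 / 4"
    and consumer_payoff_eq:
      "consumer_payoff M c v I F = gain M v I / 2 - 3 / 8 * gain M v F + (expectation v - c)\<^sup>2 / 8"
proof -
  define a where "a = real_cond_exp M F v"
  define b where "b = real_cond_exp M I v"
  define m where "m = expectation v"
  interpret F: sigma_finite_subalgebra M F using F by (rule sigma_finite_subalgebraI)
  interpret I: sigma_finite_subalgebra M I using I by (rule sigma_finite_subalgebraI)
  have aF: "a \<in> borel_measurable F" and bI: "b \<in> borel_measurable I"
    unfolding a_def b_def by simp_all
  \<comment> \<open>The inclusion of information enters here: what the producer knows is known to
    the consumer, so \<open>a\<close> may serve as the \<open>I\<close>-measurable factor in
    \<open>Eab\<close>.\<close>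
  have aI: "a \<in> borel_measurable I"
    using FI aF by (rule measurable_from_subalg)
  have [measurable]: "a \<in> borel_measurable M" "b \<in> borel_measurable M"
    unfolding a_def b_def by simp_all
  have int_v: "integrable M v"
    using v v2 by (rule square_integrable_imp_integrable)
  have int_a: "integrable M a" and Ea: "expectation a = m"
    and int_b: "integrable M b" and Eb: "expectation b = m"
    unfolding a_def b_def m_def using int_v
    by (simp_all add: F.real_cond_exp_int I.real_cond_exp_int)
  have a2: "integrable M (\<lambda>x. (a x)\<^sup>2)" and b2: "integrable M (\<lambda>x. (b x)\<^sup>2)"
    unfolding a_def b_def using F I v v2 by (simp_all add: square_integrable_cond_exp)
  have ab: "integrable M (\<lambda>x. a x * b x)" and av: "integrable M (\<lambda>x. a x * v x)"
    and bv: "integrable M (\<lambda>x. b x * v x)"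
    using a2 b2 v2 by (auto intro!: integrable_mult_of_squares)
  have Eav: "expectation (\<lambda>x. a x * v x) = expectation (\<lambda>x. (a x)\<^sup>2)"
    using expectation_mult_cond_exp[OF F aF v a2 v2] by (simp add: a_def power2_eq_square)
  have Eab: "expectation (\<lambda>x. a x * b x) = expectation (\<lambda>x. (a x)\<^sup>2)"
    using expectation_mult_cond_exp[OF I aI v a2 v2] Eav by (simp add: b_def)
  have Ebv: "expectation (\<lambda>x. b x * v x) = expectation (\<lambda>x. (b x)\<^sup>2)"
    using expectation_mult_cond_exp[OF I bI v b2 v2] by (simp add: b_def power2_eq_square)
  have gF: "gain M v F = expectation (\<lambda>x. (a x)\<^sup>2) - m\<^sup>2"
    and gI: "gain M v I = expectation (\<lambda>x. (b x)\<^sup>2) - m\<^sup>2"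
    unfolding a_def b_def m_def using F I v v2 by (simp_all add: gain_eq)
  note int = int_v int_a int_b a2 b2 ab av bv
  \<comment> \<open>The fact \<open>prob_space\<close> says that the total mass is 1; it evaluates
    the constant terms in \<open>c\<^sup>2\<close>.\<close>
  note E = Ea Eb Eav Eab Ebv m_def[symmetric] prob_space

  \<comment> \<open>Pointwise expansion of \<open>(a - c) / 2 * (b - (a + c) / 2)\<close>. The
    coefficient 1/4 of \<open>E[a\<^sup>2]\<close> arises as 1/2 from \<open>a b\<close> minus
    1/4.\<close>
  have "producer_payoff M c v I F =
      expectation (\<lambda>x. a x * b x / 2 - (a x)\<^sup>2 / 4 - c / 2 * b x + c\<^sup>2 / 4)"
    unfolding producer_payoff_def price_def quantity_def a_def b_def
    by (intro Bochner_Integration.integral_cong refl) (simp add: field_simps power2_eq_square)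
  also have "\<dots> = expectation (\<lambda>x. (a x)\<^sup>2) / 4 - c / 2 * m + c\<^sup>2 / 4"
    using int by (simp add: E)
  also have "\<dots> = gain M v F / 4 + (expectation v - c)\<^sup>2 / 4"
    unfolding gF m_def[symmetric] by (simp add: field_simps power2_eq_square)
  finally show "producer_payoff M c v I F = gain M v F / 4 + (expectation v - c)\<^sup>2 / 4" .

  \<comment> \<open>With price \<open>p\<close> and quantity \<open>b - p\<close> the terms in
    \<open>p b\<close> cancel, leaving \<open>v b - b\<^sup>2 / 2 - v p + p\<^sup>2 / 2\<close>;
    then \<open>p = (a + c) / 2\<close> is inserted. The 3/8 is 1/2 from \<open>a v\<close> minus
    1/8 from \<open>p\<^sup>2 / 2\<close>.\<close>
  have "consumer_payoff M c v I F =
      expectation (\<lambda>x. b x * v x - (b x)\<^sup>2 / 2 - a x * v x / 2 + (a x)\<^sup>2 / 8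
        - c / 2 * v x + c / 4 * a x + c\<^sup>2 / 8)"
    unfolding consumer_payoff_def price_def quantity_def a_def b_def
    by (intro Bochner_Integration.integral_cong refl) (simp add: field_simps power2_eq_square)
  also have "\<dots> = expectation (\<lambda>x. (b x)\<^sup>2) / 2 - 3 / 8 * expectation (\<lambda>x. (a x)\<^sup>2)
      - c / 4 * m + c\<^sup>2 / 8"
    using int by (simp add: E)
  also have "\<dots> = gain M v I / 2 - 3 / 8 * gain M v F + (expectation v - c)\<^sup>2 / 8"
    unfolding gF gI m_def[symmetric] by (simp add: field_simps power2_eq_square)
  finally show "consumer_payoff M c v I F =
      gain M v I / 2 - 3 / 8 * gain M v F + (expectation v - c)\<^sup>2 / 8" .
qed

text \<open>Conditioning on the trivial \<sigma>-algebra gives the constant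
  \<open>expectation v\<close>, whose variance is zero. The defining integral identity has to be
  tested on the empty set and the whole space only.\<close>

lemma gain_no_info:
  assumes "integrable M v"
  shows "gain M v (no_info M) = 0"
proof -
  interpret F: sigma_finite_subalgebra M "no_info M"
    by (intro sigma_finite_subalgebraI subalgebra_no_info refl)
  have "AE x in M. real_cond_exp M (no_info M) v x = expectation v"
  proof (rule F.real_cond_exp_charact)
    fix A assume "A \<in> sets (no_info M)"
    then show "(\<integral>x\<in>A. v x \<partial>M) = (\<integral>x\<in>A. expectation v \<partial>M)"
      using assms by (auto simp: sets_no_info set_integral_space prob_space
          set_lebesgue_integral_def[where A = "{}"])
  qed (use assms in auto)
  \<comment> \<open>The conditional expectation is known to be constant only almost everywhere, so
    the squared deviation is replaced by 0 under the integral rather than pointwise.\<close>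
  then have "gain M v (no_info M) = expectation (\<lambda>x. 0)"
    unfolding gain_def F.real_cond_exp_int(2)[OF assms]
    by (intro integral_cong_AE) auto
  then show ?thesis
    by simp
qed

end

text \<open>The generated \<sigma>-algebra is the smallest one making \<open>f\<close> measurable.
  Leaving \<open>A\<close> general allows two pieces of information to be compared with each other,
  besides comparing one with \<open>M\<close>.\<close>

lemma subalgebra_info:
  assumes "space A = space M" "f \<in> measurable A L"
  shows "subalgebra A (info M L f)"
  using sets_image_in_sets[OF assms] assms by (simp add: subalgebra_def info_def)

lemma measurable_info:
  assumes "f \<in> measurable M L"
  shows "f \<in> measurable (info M L f) L"
  unfolding info_def using assms by (intro measurable_vimage_algebra1) (auto dest: measurable_space)

lemma space_info[simp]: "space (info M L f) = space M"
  by (simp add: info_def)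

lemma measurable_data_outflow:
  assumes "data_outflow M N w e \<sigma> R u L Y" "j \<in> {0..N}"
    and "\<And>k. k \<in> {1..N} \<Longrightarrow> w k \<in> borel_measurable M"
    and "\<And>k. k \<in> {1..N} \<Longrightarrow> e k \<in> borel_measurable M"
  shows "Y j \<in> measurable M (L j)"
proof -
  obtain f where f: "f \<in> measurable (profile_space N \<Otimes>\<^sub>M R) (L j)"
    and Y: "\<And>\<omega>. \<omega> \<in> space M \<Longrightarrow> Y j \<omega> = f (profile N (observation w e \<sigma>) \<omega>, u \<omega>)"
    using assms(1,2) unfolding data_outflow_def by blast
  have [measurable]: "u \<in> measurable M R"
    using assms(1) unfolding data_outflow_def by blast
  have [measurable]: "profile N (observation w e \<sigma>) \<in> measurable M (profile_space N)"
    unfolding profile_def observation_def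
    by (intro measurable_restrict borel_measurable_add borel_measurable_times assms(3,4)) simp_all
  have "(\<lambda>\<omega>. f (profile N (observation w e \<sigma>) \<omega>, u \<omega>)) \<in> measurable M (L j)"
    by (rule measurable_compose[OF _ f]) measurable
  \<comment> \<open>The factorization of \<open>Y j\<close> through \<open>f\<close> is given on
    \<open>space M\<close> only, which is enough for measurability.\<close>
  then show ?thesis
    by (subst measurable_cong[OF Y])
qed

theorem proposition1:
  fixes M :: "'a measure"
    and N i :: nat
    and w e :: "nat \<Rightarrow> 'a \<Rightarrow> real"
    and \<mu> \<sigma> c :: real
    and R :: "'u measure" and u :: "'a \<Rightarrow> 'u"
    and L :: "nat \<Rightarrow> 'y measure" and Y :: "nat \<Rightarrow> 'a \<Rightarrow> 'y"
  assumes "prob_space M"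
    and "\<And>j. j \<in> {1..N} \<Longrightarrow> w j \<in> borel_measurable M"
    and "\<And>j. j \<in> {1..N} \<Longrightarrow> e j \<in> borel_measurable M"
    and "prob_space.indep_var M (profile_space N) (profile N w) (profile_space N) (profile N e)"
    and "exchangeable M N w" and "exchangeable M N e"
    and "\<And>j. j \<in> {1..N} \<Longrightarrow> integrable M (\<lambda>\<omega>. (w j \<omega>)\<^sup>2)"
    and "\<And>j. j \<in> {1..N} \<Longrightarrow> integrable M (\<lambda>\<omega>. (e j \<omega>)\<^sup>2)"
    and "\<And>j. j \<in> {1..N} \<Longrightarrow> prob_space.expectation M (w j) = \<mu>"
    and "\<And>j. j \<in> {1..N} \<Longrightarrow> prob_space.variance M (w j) = 1"
    and "\<And>j. j \<in> {1..N} \<Longrightarrow> prob_space.expectation M (e j) = 0"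
    and "\<And>j. j \<in> {1..N} \<Longrightarrow> prob_space.variance M (e j) = 1"
    and "\<sigma> > 0" and "c \<ge> 0"
    and "i \<in> {1..N}"
    and "data_outflow M N w e \<sigma> R u L Y"
    and "Y 0 \<in> measurable (info M (L i) (Y i)) (L 0)"
  shows "let s = observation w e \<sigma>;
             S\<^sub>i = info M borel (s i);
             SY\<^sub>i = info M (borel \<Otimes>\<^sub>M L i) (\<lambda>\<omega>. (s i \<omega>, Y i \<omega>));
             Y\<^sub>0 = info M (L 0) (Y 0);
             G = gain M (w i)
         in producer_payoff M c (w i) SY\<^sub>i Y\<^sub>0 - producer_payoff M c (w i) S\<^sub>i (no_info M)
              = 1/4 * G Y\<^sub>0
          \<and> consumer_payoff M c (w i) SY\<^sub>i Y\<^sub>0 - consumer_payoff M c (w i) S\<^sub>i (no_info M)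
              = 1/2 * (G SY\<^sub>i - G S\<^sub>i) - 3/8 * G Y\<^sub>0
          \<and> social_surplus M c (w i) SY\<^sub>i Y\<^sub>0 - social_surplus M c (w i) S\<^sub>i (no_info M)
              = 1/2 * (G SY\<^sub>i - G S\<^sub>i) - 1/8 * G Y\<^sub>0"
proof -
  interpret prob_space M by fact
  define s where "s = observation w e \<sigma>"
  define Si where "Si = info M borel (s i)"
  define SYi where "SYi = info M (borel \<Otimes>\<^sub>M L i) (\<lambda>\<omega>. (s i \<omega>, Y i \<omega>))"
  define Y0 where "Y0 = info M (L 0) (Y 0)"
  note wi = assms(2)[OF \<open>i \<in> {1..N}\<close>]
  note w2 = assms(7)[OF \<open>i \<in> {1..N}\<close>]
  have s: "s i \<in> borel_measurable M"
    unfolding s_def observation_def using assms(2,3) \<open>i \<in> {1..N}\<close> by measurable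
  have Y: "Y j \<in> measurable M (L j)" if "j \<in> {0, i}" for j
    using that \<open>i \<in> {1..N}\<close> assms(2,3) by (intro measurable_data_outflow[OF assms(16)]) auto
  have sY: "(\<lambda>\<omega>. (s i \<omega>, Y i \<omega>)) \<in> measurable M (borel \<Otimes>\<^sub>M L i)"
    using s Y by simp
  have Si: "subalgebra M Si" and SYi: "subalgebra M SYi" and Y0: "subalgebra M Y0"
    unfolding Si_def SYi_def Y0_def using s sY Y by (simp_all add: subalgebra_info)
  \<comment> \<open>The second projection recovers \<open>Y i\<close> from the pair, so
    \<open>SYi\<close> refines the information in \<open>Y i\<close>. Through it \<open>Y 0\<close>
    is measurable for \<open>SYi\<close>, which gives the inclusion that \<open>payoffs_eq\<close>
    requires.\<close>
  have "Y i \<in> measurable SYi (L i)"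
    unfolding SYi_def using measurable_compose[OF measurable_info[OF sY] measurable_snd] by simp
  then have "subalgebra SYi (info M (L i) (Y i))"
    by (intro subalgebra_info) (simp_all add: SYi_def)
  then have "Y 0 \<in> measurable SYi (L 0)"
    using assms(17) by (rule measurable_from_subalg)
  then have YSY: "subalgebra SYi Y0"
    unfolding Y0_def by (intro subalgebra_info) (simp_all add: SYi_def)
  have no: "subalgebra M (no_info M)" "subalgebra Si (no_info M)"
    by (simp_all add: subalgebra_no_info Si_def)
  have "gain M (w i) (no_info M) = 0"
    by (intro gain_no_info square_integrable_imp_integrable[OF wi w2])
  \<comment> \<open>\<open>payoffs_eq\<close> is applied twice, to the outflow and to the benchmark;
    the terms in \<open>(expectation (w i) - c)\<^sup>2\<close> cancel. For the surplus, 1/4 - 3/8 =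
    -1/8.\<close>
  then show ?thesis
    unfolding Let_def s_def[symmetric] Si_def[symmetric] SYi_def[symmetric] Y0_def[symmetric]
      social_surplus_def
    by (simp add: payoffs_eq[OF Y0 SYi YSY wi w2] payoffs_eq[OF no(1) Si no(2) wi w2] field_simps)
qed

end
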